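(* Let $n\ge 1$ and suppose that the random vector $X=(X_1,\dots,X_n)\in\{0,1\}^n$ has an $\mathrm{MTP}_2$ law. Define the symmetric matrix $C=C(X)\in\mathbb{R}^{n\times n}$ by $C_{ii}=0$ and, for $i\neq j$, $$C_{ij}=\mathbb{E}\left[\left|\mathrm{Cov}\left(X_i,X_j\,\middle|\,X_{[n]\setminus\{i,j\}}\right)\right|\right].$$ Then, for every collection of nonnegative real weights $w_{ij}$ ($1\le i<j\le n$), $$\sum_{i<j} w_{ij}C_{ij}\le 2\,\mathrm{MaxCut}(G,w)-W,\qquad W=\sum_{i<j}w_{ij},$$ where $G$ is the weighted graph on the vertex set $[n]$ with weight $w_{ij}$ on the edge $\{i,j\}$.
   Context: Write $[n]=\{1,\dots,n\}$. A probability measure $\mu$ on $\{0,1\}^n$ is multivariate totally positive of order two ($\mathrm{MTP}_2$) if $\mu(\min\{x,y\})\,\mu(\max\{x,y\})\ge\mu(x)\mu(y)$ for all $x,y\in\{0,1\}^n$, where $\min$ and $\max$ are taken coordinatewise. The measure $\mu$ is not assumed to have full support. For $A\subset[n]$, $X_A=(X_k)_{k\in A}$. $\mathrm{Cov}(X_i,X_j\mid X_{[n]\setminus\{i,j\}})$ is the conditional covariance of $X_i$ and $X_j$ given all the other coordinates, i.e. the random variable which, on the event $X_{[n]\setminus\{i,j\}}=z$ (of positive probability), equals the covariance of $X_i,X_j$ under the conditional law given that event. The outer expectation is over $X_{[n]\setminus\{i,j\}}$. Weights are symmetric, $w_{ij}=w_{ji}$. For a partition $[n]=A\sqcup A^c$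 (one part may be empty), the cut weight is $\mathrm{Cut}_w(A)=\sum_{i\in A,\,j\in A^c}w_{ij}$, and $\mathrm{MaxCut}(G,w)=\max_{A\subset[n]}\mathrm{Cut}_w(A)$. *)

theory Defs
  imports "HOL-Probability.Probability"
begin

(* Vectors in {0,1}^n are real-valued functions that are undefined outside {1..n}. *)
definition cube :: "nat \<Rightarrow> (nat \<Rightarrow> real) set" where
  "cube n = {1..n} \<rightarrow>\<^sub>E {0, 1}"

(* Intended for probability measures on {0,1}^n in which every subset of cube n is measurable. *)
definition MTP2 :: "nat \<Rightarrow> (nat \<Rightarrow> real) measure \<Rightarrow> bool" where
  "MTP2 n \<mu> \<longleftrightarrow>
     (\<forall>x\<in>cube n. \<forall>y\<in>cube n.
        measure \<mu> {\<lambda>k\<in>{1..n}. min (x k) (y k)} * measure \<mu> {\<lambda>k\<in>{1..n}. max (x k) (y k)}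
          \<ge> measure \<mu> {x} * measure \<mu> {y})"

definition covariance :: "'a measure \<Rightarrow> ('a \<Rightarrow> real) \<Rightarrow> ('a \<Rightarrow> real) \<Rightarrow> real" where
  "covariance M f g =
     (LINT x|M. (f x - (LINT y|M. f y)) * (g x - (LINT y|M. g y)))"

(* Cov(f, g | Y) for Y with finitely many values, as a function on the sample space:
   at \<omega> it is the covariance under the conditional law given the event Y = Y \<omega>.
   Its values on the null set where that event has probability 0 are irrelevant. *)
definition cond_covariance ::
    "'a measure \<Rightarrow> ('a \<Rightarrow> real) \<Rightarrow> ('a \<Rightarrow> real) \<Rightarrow> ('a \<Rightarrow> 'b) \<Rightarrow> 'a \<Rightarrow> real" where
  "cond_covariance M f g Y \<omega> =
     covariance (uniform_measure M {\<omega>' \<in> space M. Y \<omega>' = Y \<omega>}) f g"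

definition C_mat :: "'a measure \<Rightarrow> nat \<Rightarrow> ('a \<Rightarrow> nat \<Rightarrow> real) \<Rightarrow> nat \<Rightarrow> nat \<Rightarrow> real" where
  "C_mat M n X i j =
     (if i = j then 0
      else LINT \<omega>|M. \<bar>cond_covariance M (\<lambda>\<omega>'. X \<omega>' i) (\<lambda>\<omega>'. X \<omega>' j)
                          (\<lambda>\<omega>'. restrict (X \<omega>') ({1..n} - {i, j})) \<omega>\<bar>)"

lemma C_mat_sym: "C_mat M n X i j = C_mat M n X j i"
  by (simp add: C_mat_def cond_covariance_def covariance_def insert_commute mult.commute)

definition cut_weight :: "nat \<Rightarrow> (nat \<Rightarrow> nat \<Rightarrow> real) \<Rightarrow> nat set \<Rightarrow> real" where
  "cut_weight n w A = (\<Sum>i\<in>A. \<Sum>j\<in>{1..n} - A. w i j)"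

definition max_cut :: "nat \<Rightarrow> (nat \<Rightarrow> nat \<Rightarrow> real) \<Rightarrow> real" where
  "max_cut n w = Max (cut_weight n w ` Pow {1..n})"

definition edge_pairs :: "nat \<Rightarrow> (nat \<times> nat) set" where
  "edge_pairs n = {(i, j). 1 \<le> i \<and> i < j \<and> j \<le> n}"

end

theory Submission
  imports Defs
begin

text \<open>
  Let \<open>p\<close> be the law of \<open>X\<close> and \<open>V\<^sub>i(x) = (2 x\<^sub>i - 1) sqrt (p(x + e\<^sub>i))\<close>, where \<open>x + e\<^sub>i\<close> flips the
  \<open>i\<close>-th bit. These are unit vectors indexed by the cube. If the four points that agree outside
  \<open>{i, j}\<close> have masses \<open>a, b, c, d\<close> (for the values 00, 01, 10, 11), they contribute
  \<open>2 (sqrt (b c) - sqrt (a d)) \<le> 0\<close> to the inner product of \<open>V\<^sub>i\<close> and \<open>V\<^sub>j\<close> and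
  \<open>(a d - b c) / (a + b + c + d) \<le> (sqrt (a d) - sqrt (b c)) / 2\<close> to \<open>C\<^sub>i\<^sub>j\<close>. Hence
  \<open>4 C\<^sub>i\<^sub>j\<close> is at most minus the inner product.

  Now take a standard Gaussian vector \<open>g\<close> and put \<open>s\<^sub>i = sin (g \<bullet> V\<^sub>i)\<close>. Then
  \<open>E (s\<^sub>i s\<^sub>j) = sinh (V\<^sub>i \<bullet> V\<^sub>j) / e\<close>, and since \<open>e \<le> 4\<close> this gives \<open>C\<^sub>i\<^sub>j \<le> - E (s\<^sub>i s\<^sub>j)\<close>.
  Finally \<open>- \<Sum> w\<^sub>i\<^sub>j s\<^sub>i s\<^sub>j\<close> is affine in each \<open>s\<^sub>i\<close>, so on \<open>[-1, 1]\<^sup>n\<close> it is maximal at signs,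
  that is, at cuts.
\<close>

subsection \<open>Cuts and Gaussian rounding\<close>

lemma borel_measurable_linear_PiM:
  fixes t :: "'i \<Rightarrow> real"
  assumes "\<And>k. k \<in> I \<Longrightarrow> sets (N k) = sets borel"
  shows "(\<lambda>g. \<Sum>k\<in>I. t k * g k) \<in> borel_measurable (Pi\<^sub>M I N)"
proof (intro borel_measurable_sum borel_measurable_times borel_measurable_const)
  fix k assume "k \<in> I"
  then show "(\<lambda>g. g k) \<in> borel_measurable (Pi\<^sub>M I N)"
    using measurable_component_singleton[of k I N] measurable_cong_sets[OF refl assms] by blast
qed

text \<open>The cosine is the real part of \<open>iexp\<close>. By independence the mean of
  \<open>iexp\<close> factors over the coordinates into values of the standard normal characteristic
  function.\<close>

lemma integral_cos_std_normal:
  fixes t :: "'i \<Rightarrow> real"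
  assumes "finite I"
  shows "(LINT g|Pi\<^sub>M I (\<lambda>_. std_normal_distribution). cos (\<Sum>k\<in>I. t k * g k))
           = exp (- (\<Sum>k\<in>I. (t k)\<^sup>2) / 2)"
proof -
  let ?N = "std_normal_distribution"
  interpret N: real_distribution ?N
    by (rule real_dist_normal_dist)
  interpret F: finite_product_prob_space "\<lambda>_. ?N" I
    using assms by unfold_locales
  let ?P = "Pi\<^sub>M I (\<lambda>_. ?N)"
  have meas: "(\<lambda>g. \<Sum>k\<in>I. t k * g k) \<in> borel_measurable ?P"
    by (rule borel_measurable_linear_PiM) simp
  have int: "integrable ?P (\<lambda>g. iexp (\<Sum>k\<in>I. t k * g k))"
    by (rule F.integrable_const_bound[where B = 1]) (use meas in auto)
  have "(LINT g|?P. iexp (\<Sum>k\<in>I. t k * g k)) = (LINT g|?P. (\<Prod>k\<in>I. iexp (t k * g k)))"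
    using assms by (simp add: sum_distrib_left exp_sum)
  also have "\<dots> = (\<Prod>k\<in>I. char ?N (t k))"
    unfolding char_def
    by (rule F.product_integral_prod[OF assms]) (rule N.integrable_iexp; simp)
  also have "\<dots> = (\<Prod>k\<in>I. complex_of_real (exp (- (t k)\<^sup>2 / 2)))"
    by (simp add: char_std_normal_distribution)
  also have "\<dots> = complex_of_real (exp (- (\<Sum>k\<in>I. (t k)\<^sup>2) / 2))"
    using assms by (simp flip: of_real_prod exp_sum add: sum_negf sum_divide_distrib)
  finally have eq: "(LINT g|?P. iexp (\<Sum>k\<in>I. t k * g k)) = complex_of_real (exp (- (\<Sum>k\<in>I. (t k)\<^sup>2) / 2))" .
  have "Re (LINT g|?P. iexp (\<Sum>k\<in>I. t k * g k)) = (LINT g|?P. Re (iexp (\<Sum>k\<in>I. t k * g k)))"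
    using int by (rule integral_Re[symmetric])
  then show ?thesis
    unfolding eq by (simp add: Re_exp)
qed

section \<open>Forms without diagonal terms on [-1, 1]^n, and cuts\<close>

text \<open>\<open>E\<close> has no diagonal pairs, so the form is affine in each variable and one
  of the endpoints -1, 1 does not decrease it. Variables are rounded one at a time; the clause on
  \<open>i \<notin> F\<close> keeps the next one at its original value.\<close>

lemma multilinear_le_signs:
  fixes s :: "'i \<Rightarrow> real"
  assumes "finite F" and "\<And>i. i \<in> F \<Longrightarrow> \<bar>s i\<bar> \<le> 1" and "\<And>i j. (i, j) \<in> E \<Longrightarrow> i \<noteq> j"
  shows "\<exists>t. (\<forall>i\<in>F. t i \<in> {-1, 1}) \<and> (\<forall>i. i \<notin> F \<longrightarrow> t i = s i) \<and>
           (\<Sum>(i, j)\<in>E. c i j * (s i * s j)) \<le> (\<Sum>(i, j)\<in>E. c i j * (t i * t j))"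
  using assms(1,2)
proof (induction F rule: finite_induct)
  case empty
  then show ?case by auto
next
  case (insert k F)
  let ?\<phi> = "\<lambda>t :: 'i \<Rightarrow> real. \<Sum>(i, j)\<in>E. c i j * (t i * t j)"
  from insert obtain t where t: "\<forall>i\<in>F. t i \<in> {-1, 1}" "\<forall>i. i \<notin> F \<longrightarrow> t i = s i" "?\<phi> s \<le> ?\<phi> t"
    by auto
  let ?y = "s k"
  have y: "\<bar>?y\<bar> \<le> 1" "t k = ?y"
    using insert t by auto
  \<comment> \<open>The weights \<open>(1 + ?y) / 2\<close> and \<open>(1 - ?y) / 2\<close> express
    \<open>?y\<close> as a convex combination of 1 and -1.\<close>
  have "?\<phi> t = (1 + ?y) / 2 * ?\<phi> (t(k := 1)) + (1 - ?y) / 2 * ?\<phi> (t(k := -1))"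
    unfolding sum_distrib_left sum.distrib[symmetric]
  proof (rule sum.cong; clarify)
    fix i j assume "(i, j) \<in> E"
    then have "i \<noteq> j" by (rule assms(3))
    then consider "i = k" "j \<noteq> k" | "i \<noteq> k" "j = k" | "i \<noteq> k" "j \<noteq> k"
      by blast
    then show "c i j * (t i * t j) = (1 + ?y) / 2 * (c i j * ((t(k := 1)) i * (t(k := 1)) j))
        + (1 - ?y) / 2 * (c i j * ((t(k := -1)) i * (t(k := -1)) j))"
      by cases (use y(2) in \<open>auto simp: field_simps\<close>)
  qed
  moreover have "(1 + ?y) / 2 * ?\<phi> (t(k := 1)) + (1 - ?y) / 2 * ?\<phi> (t(k := -1))
      \<le> max (?\<phi> (t(k := 1))) (?\<phi> (t(k := -1)))"
    by (rule convex_bound_le) (use y in \<open>auto simp: field_simps\<close>)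
  ultimately have "?\<phi> s \<le> max (?\<phi> (t(k := 1))) (?\<phi> (t(k := -1)))"
    using t(3) by linarith
  then consider "?\<phi> s \<le> ?\<phi> (t(k := 1))" | "?\<phi> s \<le> ?\<phi> (t(k := -1))"
    by linarith
  then show ?case
  proof cases
    case 1
    then show ?thesis using t(1,2) by (intro exI[of _ "t(k := 1)"]) auto
  next
    case 2
    then show ?thesis using t(1,2) by (intro exI[of _ "t(k := -1)"]) auto
  qed
qed

lemma finite_edge_pairs: "finite (edge_pairs n)"
  by (rule finite_subset[of _ "{1..n} \<times> {1..n}"]) (auto simp: edge_pairs_def)

lemma sum_edge_pairs_sym:
  fixes f :: "nat \<Rightarrow> nat \<Rightarrow> real"
  shows "(\<Sum>i\<in>{1..n}. \<Sum>j\<in>{1..n} - {i}. f i j) = (\<Sum>(i, j)\<in>edge_pairs n. f i j + f j i)"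
proof -
  let ?E = "edge_pairs n"
  have "(\<Sum>i\<in>{1..n}. \<Sum>j\<in>{1..n} - {i}. f i j) = (\<Sum>(i, j)\<in>Sigma {1..n} (\<lambda>i. {1..n} - {i}). f i j)"
    by (rule sum.Sigma) auto
  also have "Sigma {1..n} (\<lambda>i. {1..n} - {i}) = ?E \<union> prod.swap ` ?E"
    by (force simp: edge_pairs_def image_iff)
  also have "(\<Sum>(i, j)\<in>?E \<union> prod.swap ` ?E. f i j) = (\<Sum>(i, j)\<in>?E. f i j) + (\<Sum>(i, j)\<in>prod.swap ` ?E. f i j)"
    by (rule sum.union_disjoint) (auto simp: finite_edge_pairs, auto simp: edge_pairs_def)
  also have "(\<Sum>(i, j)\<in>prod.swap ` ?E. f i j) = (\<Sum>(i, j)\<in>?E. f j i)"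
    by (subst sum.reindex) (auto intro!: sum.cong)
  finally show ?thesis
    by (simp add: sum.distrib case_prod_beta)
qed

text \<open>For signs, \<open>(1 - t i * t j) / 2\<close> is 1 when the edge is cut by the set where
  \<open>t\<close> equals 1, and 0 otherwise. Hence the form on the left is twice the weight of that
  cut minus the total weight.\<close>

lemma max_cut_ge_signs:
  fixes w :: "nat \<Rightarrow> nat \<Rightarrow> real"
  assumes sym: "\<And>i j. i \<in> {1..n} \<Longrightarrow> j \<in> {1..n} \<Longrightarrow> w i j = w j i"
    and t: "\<forall>i\<in>{1..n}. t i \<in> {-1, 1 :: real}"
  shows "(\<Sum>(i, j)\<in>edge_pairs n. - w i j * (t i * t j))
           \<le> 2 * max_cut n w - (\<Sum>(i, j)\<in>edge_pairs n. w i j)"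
proof -
  define A where "A = {i \<in> {1..n}. t i = 1}"
  have "cut_weight n w A = (\<Sum>i\<in>{1..n}. \<Sum>j\<in>{1..n} - {i}. if i \<in> A \<and> j \<notin> A then w i j else 0)"
  proof -
    have "cut_weight n w A = (\<Sum>i\<in>{1..n}. if i \<in> A then \<Sum>j\<in>{1..n} - A. w i j else 0)"
      unfolding cut_weight_def
      by (rule sum.mono_neutral_cong_left) (auto simp: A_def)
    also have "\<dots> = (\<Sum>i\<in>{1..n}. \<Sum>j\<in>{1..n} - {i}. if i \<in> A \<and> j \<notin> A then w i j else 0)"
      by (intro sum.cong refl) (auto intro!: sum.mono_neutral_cong_left)
    finally show ?thesis .
  qed
  also have "\<dots> = (\<Sum>(i, j)\<in>edge_pairs n. (if i \<in> A \<and> j \<notin> A then w i j else 0) + (if j \<in> A \<and> i \<notin> A then w j i else 0))"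
    by (rule sum_edge_pairs_sym)
  also have "\<dots> = (\<Sum>(i, j)\<in>edge_pairs n. w i j * (1 - t i * t j) / 2)"
  proof (rule sum.cong; clarify?)
    fix i j assume "(i, j) \<in> edge_pairs n"
    then have ij: "i \<in> {1..n}" "j \<in> {1..n}"
      by (auto simp: edge_pairs_def)
    moreover have "t i \<in> {-1, 1}" "t j \<in> {-1, 1}"
      using t ij by auto
    ultimately show "(if i \<in> A \<and> j \<notin> A then w i j else 0) + (if j \<in> A \<and> i \<notin> A then w j i else 0)
        = w i j * (1 - t i * t j) / 2"
      using sym[OF ij] by (auto simp: A_def)
  qed
  finally have "2 * cut_weight n w A - (\<Sum>(i, j)\<in>edge_pairs n. w i j)
      = (\<Sum>(i, j)\<in>edge_pairs n. - w i j * (t i * t j))"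
    by (simp add: sum_distrib_left sum_subtractf[symmetric] case_prod_beta field_simps)
  moreover have "cut_weight n w A \<le> max_cut n w"
    unfolding max_cut_def by (rule Max_ge) (auto simp: A_def)
  ultimately show ?thesis by linarith
qed

lemma max_cut_ge_unit_interval:
  fixes w :: "nat \<Rightarrow> nat \<Rightarrow> real"
  assumes "\<And>i j. i \<in> {1..n} \<Longrightarrow> j \<in> {1..n} \<Longrightarrow> w i j = w j i" and "\<And>i. \<bar>s i\<bar> \<le> (1 :: real)"
  shows "(\<Sum>(i, j)\<in>edge_pairs n. - w i j * (s i * s j))
           \<le> 2 * max_cut n w - (\<Sum>(i, j)\<in>edge_pairs n. w i j)"
proof -
  obtain t where "\<forall>i\<in>{1..n}. t i \<in> {-1, 1}"
    and "(\<Sum>(i, j)\<in>edge_pairs n. - w i j * (s i * s j)) \<le> (\<Sum>(i, j)\<in>edge_pairs n. - w i j * (t i * t j))"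
    using multilinear_le_signs[of "{1..n}" s "edge_pairs n" "\<lambda>i j. - w i j"] assms(2)
    by (auto simp: edge_pairs_def)
  with max_cut_ge_signs[of n w t] assms(1) show ?thesis
    by fastforce
qed

section \<open>Gaussian rounding by the sine\<close>

text \<open>The cut bound holds pointwise for the values \<open>s i g\<close> and is integrated over
  \<open>g\<close>. The hypothesis \<open>neg\<close> makes minus the inner product nonnegative,
  which is the range where sinh r is at least r.\<close>

lemma max_cut_ge_gram:
  fixes w :: "nat \<Rightarrow> nat \<Rightarrow> real" and V :: "nat \<Rightarrow> 'i \<Rightarrow> real"
  assumes "finite I"
    and sym: "\<And>i j. i \<in> {1..n} \<Longrightarrow> j \<in> {1..n} \<Longrightarrow> w i j = w j i"
    and w: "\<And>i j. (i, j) \<in> edge_pairs n \<Longrightarrow> w i j \<ge> 0"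
    and unit: "\<And>i. i \<in> {1..n} \<Longrightarrow> (\<Sum>k\<in>I. (V i k)\<^sup>2) = 1"
    and neg: "\<And>i j. (i, j) \<in> edge_pairs n \<Longrightarrow> (\<Sum>k\<in>I. V i k * V j k) \<le> 0"
  shows "(\<Sum>(i, j)\<in>edge_pairs n. w i j * (- (\<Sum>k\<in>I. V i k * V j k) / 4))
           \<le> 2 * max_cut n w - (\<Sum>(i, j)\<in>edge_pairs n. w i j)" (is "_ \<le> ?B")
proof -
  let ?N = "std_normal_distribution"
  interpret N: real_distribution ?N
    by (rule real_dist_normal_dist)
  interpret F: finite_product_prob_space "\<lambda>_. ?N" I
    using assms by unfold_locales
  let ?P = "Pi\<^sub>M I (\<lambda>_. ?N)"
  define s where "s i g = sin (\<Sum>k\<in>I. V i k * g k)" for i and g :: "'i \<Rightarrow> real"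
  have lin: "(\<lambda>g. \<Sum>k\<in>I. t k * g k) \<in> borel_measurable ?P" for t :: "'i \<Rightarrow> real"
    by (rule borel_measurable_linear_PiM) simp
  have cos_int: "integrable ?P (\<lambda>g. cos (\<Sum>k\<in>I. t k * g k))" for t :: "'i \<Rightarrow> real"
    by (rule F.integrable_const_bound[where B = 1]) (use lin in auto)
  \<comment> \<open>The product-to-sum formula leaves cosines of linear forms, whose means
    \<open>integral_cos_std_normal\<close> evaluates.\<close>
  have ss: "s i g * s j g = (cos (\<Sum>k\<in>I. (V i k - V j k) * g k) - cos (\<Sum>k\<in>I. (V i k + V j k) * g k)) / 2" for i j g
    by (simp add: s_def sin_times_sin left_diff_distrib distrib_right sum.distrib sum_subtractf)
  have ss_int: "integrable ?P (\<lambda>g. s i g * s j g)" for i j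
    unfolding ss by (intro integrable_divide_zero Bochner_Integration.integrable_diff) (use cos_int in auto)
  have corr: "- (\<Sum>k\<in>I. V i k * V j k) / 4 \<le> - (LINT g|?P. s i g * s j g)" if ij: "(i, j) \<in> edge_pairs n" for i j
  proof -
    let ?r = "- (\<Sum>k\<in>I. V i k * V j k)"
    have u: "(\<Sum>k\<in>I. (V i k)\<^sup>2) = 1" "(\<Sum>k\<in>I. (V j k)\<^sup>2) = 1"
      using ij by (auto intro!: unit simp: edge_pairs_def)
    have n1: "(\<Sum>k\<in>I. (V i k - V j k)\<^sup>2) = 2 + 2 * ?r"
      using u by (simp add: power2_diff sum.distrib sum_subtractf sum_distrib_left[symmetric] mult.assoc)
    have n2: "(\<Sum>k\<in>I. (V i k + V j k)\<^sup>2) = 2 - 2 * ?r"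
      using u by (simp add: power2_sum sum.distrib sum_subtractf sum_distrib_left[symmetric] mult.assoc)
    have "(LINT g|?P. s i g * s j g) = (exp (- (2 + 2 * ?r) / 2) - exp (- (2 - 2 * ?r) / 2)) / 2"
      unfolding ss using cos_int
      by (simp only: integral_divide_zero Bochner_Integration.integral_diff integral_cos_std_normal[OF assms(1)] n1 n2)
    \<comment> \<open>The exponents are -1 - r and -1 + r. Factoring out \<open>exp (-1)\<close>
      leaves minus sinh r, spelled as in \<open>real_le_x_sinh\<close>.\<close>
    also have "\<dots> = - (exp (-1) * ((exp ?r - inverse (exp ?r)) / 2))"
      by (simp add: exp_minus[symmetric] right_diff_distrib diff_divide_distrib mult_exp_exp add_divide_distrib)
    finally have "- (LINT g|?P. s i g * s j g) = exp (-1) * ((exp ?r - inverse (exp ?r)) / 2)"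
      by linarith
    moreover have "exp (-1) * ((exp ?r - inverse (exp ?r)) / 2) \<ge> 1 / 4 * ?r"
    proof (rule mult_mono)
      \<comment> \<open>The bound e \<le> 3 from \<open>exp_le\<close> more than suffices.\<close>
      show "1 / 4 \<le> exp (-1 :: real)"
        using exp_le by (simp add: exp_minus field_simps)
      show "?r \<le> (exp ?r - inverse (exp ?r)) / 2"
        by (rule real_le_x_sinh) (use neg[OF ij] in auto)
    qed (use neg[OF ij] in auto)
    ultimately show ?thesis by simp
  qed
  have "(\<Sum>(i, j)\<in>edge_pairs n. w i j * (- (\<Sum>k\<in>I. V i k * V j k) / 4))
      \<le> (\<Sum>(i, j)\<in>edge_pairs n. w i j * - (LINT g|?P. s i g * s j g))"
    unfolding case_prod_beta by (rule sum_mono, rule mult_left_mono) (use corr w in auto)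
  also have "\<dots> = (LINT g|?P. (\<Sum>(i, j)\<in>edge_pairs n. - w i j * (s i g * s j g)))"
    using ss_int by (simp add: case_prod_beta)
  also have "\<dots> \<le> (LINT g|?P. ?B)"
  proof (rule integral_mono)
    show "integrable ?P (\<lambda>g. \<Sum>(i, j)\<in>edge_pairs n. - w i j * (s i g * s j g))"
      using ss_int by (simp add: case_prod_beta)
    show "(\<Sum>(i, j)\<in>edge_pairs n. - w i j * (s i g * s j g)) \<le> ?B" for g
      by (rule max_cut_ge_unit_interval) (use sym in \<open>auto simp: s_def\<close>)
  qed simp
  also have "\<dots> = ?B"
    using prob_space.prob_space[OF prob_space_PiM, of I "\<lambda>_. ?N"] N.prob_space_axioms by simp
  finally show ?thesis .
qed

subsection \<open>Conditional covariances of binary vectors\<close>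

lemma finite_cube: "finite (cube n)"
  unfolding cube_def by (rule finite_PiE) auto

lemma cube_upd: "x \<in> cube n \<Longrightarrow> i \<in> {1..n} \<Longrightarrow> u \<in> {0, 1} \<Longrightarrow> x(i := u) \<in> cube n"
  unfolding cube_def by (auto simp: PiE_iff extensional_def)

lemma cube_range: "x \<in> cube n \<Longrightarrow> i \<in> {1..n} \<Longrightarrow> x i = 0 \<or> x i = 1"
  unfolding cube_def by (drule (1) PiE_mem) simp

lemma cube_eqI:
  assumes "x \<in> cube n" "y \<in> cube n" "\<And>k. k \<in> {1..n} \<Longrightarrow> x k = y k"
  shows "x = y"
  using assms unfolding cube_def by (intro PiE_ext)

lemma sum_cube_flip:
  assumes i: "i \<in> {1..n}"
  shows "(\<Sum>x\<in>cube n. f (x(i := 1 - x i))) = (\<Sum>x\<in>cube n. f x)"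
proof (rule sum.reindex_bij_witness[where i = "\<lambda>x. x(i := 1 - x i)" and j = "\<lambda>x. x(i := 1 - x i)"])
  fix x assume x: "x \<in> cube n"
  show "x(i := 1 - x i) \<in> cube n"
    by (rule cube_upd[OF x i]) (use cube_range[OF x i] in auto)
  then show "x(i := 1 - x i) \<in> cube n" .
qed auto

lemma sum_cube_average:
  fixes f :: "(nat \<Rightarrow> real) \<Rightarrow> real"
  assumes i: "i \<in> {1..n}"
  shows "(\<Sum>x\<in>cube n. f x) = (\<Sum>x\<in>cube n. (f (x(i := 0)) + f (x(i := 1))) / 2)"
proof -
  have "2 * (\<Sum>x\<in>cube n. f x) = (\<Sum>x\<in>cube n. f x + f (x(i := 1 - x i)))"
    unfolding sum.distrib sum_cube_flip[OF i] by simp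
  also have "\<dots> = (\<Sum>x\<in>cube n. f (x(i := 0)) + f (x(i := 1)))"
  proof (rule sum.cong)
    fix x assume "x \<in> cube n"
    then show "f x + f (x(i := 1 - x i)) = f (x(i := 0)) + f (x(i := 1))"
      using cube_range[of x n i] i by (auto simp: fun_upd_idem)
  qed simp
  finally show ?thesis
    by (simp add: sum_divide_distrib[symmetric])
qed

text \<open>Lets an inequality on the four points that differ only in bits \<open>i\<close> and
  \<open>j\<close> be summed over the whole cube without choosing representatives: each such
  quadruple is visited four times, hence the factor 1/4.\<close>

lemma sum_cube_average2:
  fixes f :: "(nat \<Rightarrow> real) \<Rightarrow> real"
  assumes "i \<in> {1..n}" "j \<in> {1..n}"
  shows "(\<Sum>x\<in>cube n. f x) =
    (\<Sum>x\<in>cube n. (f (x(i := 0, j := 0)) + f (x(i := 0, j := 1)) +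
                    f (x(i := 1, j := 0)) + f (x(i := 1, j := 1))) / 4)"
  by (subst sum_cube_average[OF assms(2)], subst sum_cube_average[OF assms(1)])
     (simp add: add_divide_distrib algebra_simps)

section \<open>Expectations and covariances of finitely valued variables\<close>

lemma (in prob_space) expectation_finite_range:
  fixes h :: "'b \<Rightarrow> real"
  assumes "finite S" and Y: "Y \<in> measurable M (count_space S)"
  shows "(LINT \<omega>|M. h (Y \<omega>)) = (\<Sum>s\<in>S. prob {\<omega> \<in> space M. Y \<omega> = s} * h s)"
proof -
  have ev: "{\<omega> \<in> space M. Y \<omega> = s} \<in> events" if "s \<in> S" for s
    using measurable_sets[OF Y, of "{s}"] that by (simp add: vimage_def Int_def conj_commute)
  have "(LINT \<omega>|M. h (Y \<omega>)) = (LINT \<omega>|M. (\<Sum>s\<in>S. indicator {\<omega> \<in> space M. Y \<omega> = s} \<omega> * h s))"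
  proof (rule Bochner_Integration.integral_cong[OF refl])
    fix \<omega> assume \<omega>: "\<omega> \<in> space M"
    then have "Y \<omega> \<in> S"
      using measurable_space[OF Y] by simp
    then show "h (Y \<omega>) = (\<Sum>s\<in>S. indicator {\<omega> \<in> space M. Y \<omega> = s} \<omega> * h s)"
      using \<omega> assms(1) by (simp add: indicator_def if_distrib[of "\<lambda>a. a * _"] sum.delta cong: if_cong)
  qed
  also have "\<dots> = (\<Sum>s\<in>S. prob {\<omega> \<in> space M. Y \<omega> = s} * h s)"
    using ev by (subst Bochner_Integration.integral_sum) (auto simp: emeasure_eq_measure)
  finally show ?thesis .
qed

lemma (in prob_space) covariance_binary:
  fixes f g :: "'a \<Rightarrow> real"
  defines "m u v \<equiv> prob {\<omega> \<in> space M. (f \<omega>, g \<omega>) = (u, v)}"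
  assumes meas: "(\<lambda>\<omega>. (f \<omega>, g \<omega>)) \<in> measurable M (count_space ({0, 1} \<times> {0, 1}))"
  shows "covariance M f g = m 0 0 * m 1 1 - m 0 1 * m 1 0"
    and "m 0 0 + m 0 1 + m 1 0 + m 1 1 = 1"
proof -
  let ?S = "{0, 1} \<times> {0, 1 :: real}"
  have S: "?S = {(0, 0), (0, 1), (1, 0), (1, 1)}" by auto
  have E: "(LINT \<omega>|M. h (f \<omega>) (g \<omega>)) = m 0 0 * h 0 0 + m 0 1 * h 0 1 + m 1 0 * h 1 0 + m 1 1 * h 1 1"
    for h :: "real \<Rightarrow> real \<Rightarrow> real"
    using expectation_finite_range[OF _ meas, of "\<lambda>(u, v). h u v"]
    by (simp add: S m_def)
  show one: "m 0 0 + m 0 1 + m 1 0 + m 1 1 = 1"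
    using E[of "\<lambda>_ _. 1"] by (simp add: prob_space)
  have Ef: "(LINT \<omega>|M. f \<omega>) = m 1 0 + m 1 1" and Eg: "(LINT \<omega>|M. g \<omega>) = m 0 1 + m 1 1"
    using E[of "\<lambda>u _. u"] E[of "\<lambda>_ v. v"] by simp_all
  \<comment> \<open>Eliminating \<open>m 0 0\<close> by the total mass turns the centred formula and
    the determinant into the same polynomial.\<close>
  have m00: "m 0 0 = 1 - m 0 1 - m 1 0 - m 1 1"
    using one by simp
  show "covariance M f g = m 0 0 * m 1 1 - m 0 1 * m 1 0"
    unfolding covariance_def Ef Eg E[of "\<lambda>u v. (u - (m 1 0 + m 1 1)) * (v - (m 0 1 + m 1 1))"]
    unfolding m00 by (simp add: algebra_simps)
qed

text \<open>The numerator is a difference of squares of \<open>sqrt (a * d)\<close> and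
  \<open>sqrt (b * c)\<close>. By AM-GM the sum of these roots is at most half the
  denominator.\<close>

lemma diff_div_sum_sq_le_sqrt_diff:
  fixes a b c d :: real
  assumes nonneg: "0 \<le> a" "0 \<le> b" "0 \<le> c" "0 \<le> d" and "b * c \<le> a * d"
  shows "(a * d - b * c) / (a + b + c + d) \<le> (sqrt (a * d) - sqrt (b * c)) / 2"
proof (cases "a + b + c + d = 0")
  \<comment> \<open>Division by zero gives 0, and the right-hand side is nonnegative.\<close>
  case True
  then show ?thesis using assms by simp
next
  case False
  let ?s = "a + b + c + d"
  have "0 < ?s" using False nonneg by linarith
  have le: "sqrt (b * c) \<le> sqrt (a * d)" using assms by simp
  have "a * d - b * c = (sqrt (a * d) - sqrt (b * c)) * (sqrt (a * d) + sqrt (b * c))"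
    using nonneg by (simp add: algebra_simps flip: power2_eq_square)
  also have "\<dots> \<le> (sqrt (a * d) - sqrt (b * c)) * (?s / 2)"
    using arith_geo_mean_sqrt[of a d] arith_geo_mean_sqrt[of b c] nonneg le
    by (intro mult_left_mono) auto
  finally show ?thesis
    using \<open>0 < ?s\<close> by (simp add: field_simps)
qed

section \<open>The conditional law of two bits given the others\<close>

locale binary_vector = prob_space M for M :: "'a measure" +
  fixes n :: nat and X :: "'a \<Rightarrow> nat \<Rightarrow> real"
  assumes X_measurable: "X \<in> measurable M (count_space (cube n))"
begin

definition p :: "(nat \<Rightarrow> real) \<Rightarrow> real" where
  "p x = prob {\<omega> \<in> space M. X \<omega> = x}"

lemma X_in_cube: "\<omega> \<in> space M \<Longrightarrow> X \<omega> \<in> cube n"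
  using measurable_space[OF X_measurable] by simp

lemma p_nonneg: "0 \<le> p x"
  by (simp add: p_def)

lemma sum_p: "(\<Sum>x\<in>cube n. p x) = 1"
  using expectation_finite_range[OF finite_cube X_measurable, of "\<lambda>_. 1"] by (simp add: p_def prob_space)

lemma measure_distr_eq_p:
  assumes "x \<in> cube n"
  shows "measure (distr M (count_space (cube n)) X) {x} = p x"
  using assms by (subst measure_distr[OF X_measurable]) (auto simp: p_def intro!: arg_cong[where f = prob])

context
  fixes i j :: nat
  assumes ij: "i \<in> {1..n}" "j \<in> {1..n}" "i \<noteq> j"
begin

abbreviation "rest x \<equiv> restrict x ({1..n} - {i, j})"

abbreviation "fibre x \<equiv> {\<omega> \<in> space M. rest (X \<omega>) = rest x}"

lemma coordinates_measurable:
  "(\<lambda>\<omega>. (X \<omega> i, X \<omega> j)) \<in> measurable M (count_space ({0, 1} \<times> {0, 1}))"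
proof (rule measurable_compose[OF X_measurable])
  have "(y i, y j) \<in> {0, 1} \<times> {0, 1}" if "y \<in> cube n" for y
    using cube_range[OF that ij(1)] cube_range[OF that ij(2)] by blast
  then show "(\<lambda>y. (y i, y j)) \<in> measurable (count_space (cube n)) (count_space ({0, 1} \<times> {0, 1}))"
    unfolding measurable_count_space_eq1 space_count_space by (rule Pi_I)
qed

lemma fibre_event: "fibre x \<in> events"
proof -
  have "fibre x = X -` {y \<in> cube n. rest y = rest x} \<inter> space M"
    using X_in_cube by auto
  also have "\<dots> \<in> events"
    by (rule measurable_sets[OF X_measurable]) simp
  finally show ?thesis .
qed

text \<open>Knowing the two remaining bits determines \<open>X\<close>, so conditional probabilities
  become ratios with point masses \<open>p\<close> as numerators.\<close>

lemma fibre_Int: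
  assumes "x \<in> cube n" "u \<in> {0, 1}" "v \<in> {0, 1}"
  shows "fibre x \<inter> {\<omega> \<in> space M. (X \<omega> i, X \<omega> j) = (u, v)} = {\<omega> \<in> space M. X \<omega> = x(i := u, j := v)}"
proof -
  have "X \<omega> = x(i := u, j := v)"
    if "\<omega> \<in> space M" "rest (X \<omega>) = rest x" "X \<omega> i = u" "X \<omega> j = v" for \<omega>
  proof (rule cube_eqI[of _ n])
    show "x(i := u, j := v) \<in> cube n"
      using assms ij by (intro cube_upd) auto
    fix k assume "k \<in> {1..n}"
    then show "X \<omega> k = (x(i := u, j := v)) k"
      using that(3,4) fun_cong[OF that(2), of k] by (auto simp add: restrict_apply simp del: atLeastAtMost_iff split: if_splits)
  qed (use that X_in_cube in auto)
  note 1 = this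
  have 2: "rest (x(i := u, j := v)) = rest x" "(x(i := u, j := v)) i = u" "(x(i := u, j := v)) j = v"
    using ij(3) by (auto simp: restrict_def)
  show ?thesis
  proof (rule set_eqI)
    fix \<omega>
    show "\<omega> \<in> fibre x \<inter> {\<omega> \<in> space M. (X \<omega> i, X \<omega> j) = (u, v)} \<longleftrightarrow>
        \<omega> \<in> {\<omega> \<in> space M. X \<omega> = x(i := u, j := v)}"
      using 1[of \<omega>] 2 by (auto simp del: fun_upd_apply)
  qed
qed

text \<open>Conditioning divides each of the four masses by the mass of the fibre. The determinant
  of \<open>covariance_binary\<close> is quadratic in them, hence the square.\<close>

lemma fibre_covariance:
  assumes x: "x \<in> cube n" and pos: "0 < prob (fibre x)"
  defines "q u v \<equiv> p (x(i := u, j := v))"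
  shows "covariance (uniform_measure M (fibre x)) (\<lambda>\<omega>. X \<omega> i) (\<lambda>\<omega>. X \<omega> j)
           = (q 0 0 * q 1 1 - q 0 1 * q 1 0) / (prob (fibre x))\<^sup>2"
    and "q 0 0 + q 0 1 + q 1 0 + q 1 1 = prob (fibre x)"
proof -
  let ?N = "uniform_measure M (fibre x)"
  have em: "emeasure M (fibre x) \<noteq> 0" "emeasure M (fibre x) \<noteq> \<infinity>"
    using pos by (auto simp: emeasure_eq_measure)
  interpret N: prob_space ?N
    using em by (rule prob_space_uniform_measure)
  have meas: "(\<lambda>\<omega>. (X \<omega> i, X \<omega> j)) \<in> measurable ?N (count_space ({0, 1} \<times> {0, 1}))"
    using coordinates_measurable by simp
  have m: "N.prob {\<omega> \<in> space ?N. (X \<omega> i, X \<omega> j) = (u, v)} = q u v / prob (fibre x)"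
    if "u \<in> {0, 1}" "v \<in> {0, 1}" for u v
  proof -
    have "{\<omega> \<in> space M. (X \<omega> i, X \<omega> j) = (u, v)} = (\<lambda>\<omega>. (X \<omega> i, X \<omega> j)) -` {(u, v)} \<inter> space M"
      by auto
    also have "\<dots> \<in> events"
      by (rule measurable_sets[OF coordinates_measurable]) (use that in auto)
    finally have "{\<omega> \<in> space M. (X \<omega> i, X \<omega> j) = (u, v)} \<in> events" .
    from measure_uniform_measure[OF em this] show ?thesis
      unfolding fibre_Int[OF x that] by (simp add: q_def p_def)
  qed
  show "covariance ?N (\<lambda>\<omega>. X \<omega> i) (\<lambda>\<omega>. X \<omega> j)
      = (q 0 0 * q 1 1 - q 0 1 * q 1 0) / (prob (fibre x))\<^sup>2"
    using N.covariance_binary(1)[OF meas] by (simp only: m insert_iff simp_thms) (simp add: power2_eq_square diff_divide_distrib)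
  have "(q 0 0 + q 0 1 + q 1 0 + q 1 1) / prob (fibre x) = 1"
    using N.covariance_binary(2)[OF meas] by (simp only: m insert_iff simp_thms add_divide_distrib)
  then show "q 0 0 + q 0 1 + q 1 0 + q 1 1 = prob (fibre x)"
    using pos by simp
qed

end

(* Where x and its flip both have positive mass, this is sqrt (p x) times the value at x of X_i - E[X_i | rest]
   divided by its conditional standard deviation; in this form it needs no full support. *)
definition score :: "nat \<Rightarrow> (nat \<Rightarrow> real) \<Rightarrow> real" where
  "score i x = (2 * x i - 1) * sqrt (p (x(i := 1 - x i)))"

lemma score_unit:
  assumes i: "i \<in> {1..n}"
  shows "(\<Sum>x\<in>cube n. (score i x)\<^sup>2) = 1"
proof -
  have "(\<Sum>x\<in>cube n. (score i x)\<^sup>2) = (\<Sum>x\<in>cube n. p (x(i := 1 - x i)))"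
  proof (rule sum.cong)
    fix x assume "x \<in> cube n"
    then have "x i = 0 \<or> x i = 1"
      using i by (rule cube_range)
    then have "(2 * x i - 1)\<^sup>2 = 1"
      by auto
    then show "(score i x)\<^sup>2 = p (x(i := 1 - x i))"
      by (simp add: score_def p_nonneg power_mult_distrib)
  qed simp
  then show ?thesis
    by (simp add: sum_cube_flip[OF i] sum_p)
qed

text \<open>Within a quadruple, the two points with equal bits each contribute plus the root of the
  mixed masses, and the two with different bits each contribute minus the root of the 00 and 11
  masses. Two of each, averaged over four points, leave the factor 1/2.\<close>

lemma score_inner:
  assumes ij: "i \<in> {1..n}" "j \<in> {1..n}" "i \<noteq> j"
  shows "(\<Sum>x\<in>cube n. score i x * score j x) =
    - (\<Sum>x\<in>cube n. (sqrt (p (x(i := 0, j := 0)) * p (x(i := 1, j := 1)))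
                      - sqrt (p (x(i := 0, j := 1)) * p (x(i := 1, j := 0)))) / 2)"
proof -
  \<comment> \<open>Flipping bit \<open>i\<close> after both bits are set produces a third update;
    this restores the form used in the statement.\<close>
  have upd: "x(i := u, j := v, i := u') = x(i := u', j := v)"
    for x :: "nat \<Rightarrow> real" and u v u'
    using ij(3) by auto
  show ?thesis
    unfolding sum_negf[symmetric]
    by (subst sum_cube_average2[OF ij(1,2)])
       (rule sum.cong; use ij(3) in \<open>simp add: score_def upd real_sqrt_mult field_simps\<close>)
qed

section \<open>Consequences of total positivity\<close>

lemma MTP2_D:
  assumes "MTP2 n (distr M (count_space (cube n)) X)"
    and ij: "i \<in> {1..n}" "j \<in> {1..n}" "i \<noteq> j" and x: "x \<in> cube n"
  shows "p (x(i := 0, j := 1)) * p (x(i := 1, j := 0)) \<le> p (x(i := 0, j := 0)) * p (x(i := 1, j := 1))"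
proof -
  have c: "x(i := u, j := v) \<in> cube n" if "u \<in> {0, 1}" "v \<in> {0, 1}" for u v
    using ij x that by (intro cube_upd)
  \<comment> \<open>The coordinatewise minimum and maximum are restricted to \<open>{1..n}\<close>;
    they equal updates of \<open>x\<close> as functions because \<open>x\<close> has the same
    default value outside.\<close>
  have out: "x k = undefined" if "k \<notin> {1..n}" for k
    using x that by (auto simp: cube_def PiE_iff extensional_def)
  have "(\<lambda>k\<in>{1..n}. min ((x(i := 0, j := 1)) k) ((x(i := 1, j := 0)) k)) = x(i := 0, j := 0)"
    and "(\<lambda>k\<in>{1..n}. max ((x(i := 0, j := 1)) k) ((x(i := 1, j := 0)) k)) = x(i := 1, j := 1)"
    using ij out by (auto simp: fun_eq_iff restrict_apply)
  moreover have "x(i := 0, j := 1) \<in> cube n" "x(i := 1, j := 0) \<in> cube n"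
    by (rule c; simp)+
  note bspec[OF bspec[OF assms(1)[unfolded MTP2_def] this(1)] this(2)]
  ultimately show ?thesis
    by (simp only: measure_distr_eq_p c insert_iff simp_thms)
qed

text \<open>The expectation becomes a cube sum and is compared with \<open>score_inner\<close> one
  quadruple at a time, by \<open>diff_div_sum_sq_le_sqrt_diff\<close>.\<close>

lemma C_mat_le_score_inner:
  assumes mtp: "MTP2 n (distr M (count_space (cube n)) X)"
    and ij: "i \<in> {1..n}" "j \<in> {1..n}" "i \<noteq> j"
  shows "C_mat M n X i j \<le> - (\<Sum>x\<in>cube n. score i x * score j x) / 4"
proof -
  define h where "h x = \<bar>covariance (uniform_measure M (fibre i j x)) (\<lambda>\<omega>. X \<omega> i) (\<lambda>\<omega>. X \<omega> j)\<bar>" for x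
  let ?q = "\<lambda>x u v. p (x(i := u, j := v))"
  \<comment> \<open>The conditioning event ignores bits \<open>i\<close> and \<open>j\<close>, so
    \<open>h\<close> is constant on each quadruple.\<close>
  have h_upd: "h (x(i := u, j := v)) = h x" for x u v
  proof -
    have "rest i j (x(i := u, j := v)) = rest i j x"
      by (auto simp: restrict_def)
    then show ?thesis by (simp add: h_def)
  qed
  have local: "(?q x 0 0 + ?q x 0 1 + ?q x 1 0 + ?q x 1 1) * h x
      \<le> (sqrt (?q x 0 0 * ?q x 1 1) - sqrt (?q x 0 1 * ?q x 1 0)) / 2" if x: "x \<in> cube n" for x
  proof (cases "prob (fibre i j x) = 0")
    \<comment> \<open>On a null fibre all four masses vanish, so both sides are 0 whatever value
      \<open>h x\<close> takes there.\<close>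
    case True
    have "?q x u v \<le> prob (fibre i j x)" if "u \<in> {0, 1}" "v \<in> {0, 1}" for u v
      unfolding p_def fibre_Int[OF ij x that, symmetric]
      by (rule finite_measure_mono[OF Int_lower1 fibre_event[OF ij]])
    then have "?q x u v = 0" if "u \<in> {0, 1}" "v \<in> {0, 1}" for u v
      using that True p_nonneg[of "x(i := u, j := v)"] by fastforce
    then show ?thesis by simp
  next
    case False
    then have pos: "0 < prob (fibre i j x)"
      using measure_nonneg[of M "fibre i j x"] by linarith
    note fc = fibre_covariance[OF ij x pos]
    have le: "?q x 0 1 * ?q x 1 0 \<le> ?q x 0 0 * ?q x 1 1"
      by (rule MTP2_D[OF mtp ij x])
    \<comment> \<open>\<open>le\<close> removes the absolute value, and the mass of the fibre
      cancels one of the two powers in the denominator.\<close>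
    have "(?q x 0 0 + ?q x 0 1 + ?q x 1 0 + ?q x 1 1) * h x
        = (?q x 0 0 * ?q x 1 1 - ?q x 0 1 * ?q x 1 0) / (?q x 0 0 + ?q x 0 1 + ?q x 1 0 + ?q x 1 1)"
      unfolding h_def fc using le pos by (simp add: power2_eq_square)
    also have "\<dots> \<le> (sqrt (?q x 0 0 * ?q x 1 1) - sqrt (?q x 0 1 * ?q x 1 0)) / 2"
      using diff_div_sum_sq_le_sqrt_diff[OF p_nonneg p_nonneg p_nonneg p_nonneg le]
      by (simp add: algebra_simps)
    finally show ?thesis .
  qed
  \<comment> \<open>The conditioning event at \<omega> is the fibre of \<open>X \<omega>\<close>, so
    the integrand depends on \<omega> only through \<open>X \<omega>\<close>.\<close>
  have "C_mat M n X i j = (LINT \<omega>|M. h (X \<omega>))"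
    using ij(3) by (simp add: C_mat_def cond_covariance_def h_def)
  also have "\<dots> = (\<Sum>x\<in>cube n. p x * h x)"
    unfolding p_def by (rule expectation_finite_range[OF finite_cube X_measurable])
  also have "\<dots> = (\<Sum>x\<in>cube n. (?q x 0 0 + ?q x 0 1 + ?q x 1 0 + ?q x 1 1) * h x / 4)"
    by (subst sum_cube_average2[OF ij(1,2)]) (simp only: h_upd distrib_right)
  also have "\<dots> \<le> (\<Sum>x\<in>cube n. (sqrt (?q x 0 0 * ?q x 1 1) - sqrt (?q x 0 1 * ?q x 1 0)) / 2 / 4)"
    by (intro sum_mono divide_right_mono local) auto
  also have "\<dots> = - (\<Sum>x\<in>cube n. score i x * score j x) / 4"
    unfolding score_inner[OF ij] by (simp add: sum_divide_distrib)
  finally show ?thesis .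
qed

lemma score_inner_nonpos:
  assumes mtp: "MTP2 n (distr M (count_space (cube n)) X)"
    and ij: "i \<in> {1..n}" "j \<in> {1..n}" "i \<noteq> j"
  shows "(\<Sum>x\<in>cube n. score i x * score j x) \<le> 0"
  unfolding score_inner[OF ij] neg_le_0_iff_le
  by (rule sum_nonneg) (use MTP2_D[OF mtp ij] in simp)

end

theorem theorem1:
  fixes M :: "'a measure" and n :: nat and X :: "'a \<Rightarrow> nat \<Rightarrow> real"
    and w :: "nat \<Rightarrow> nat \<Rightarrow> real"
  assumes "prob_space M"
    and "n \<ge> 1"
    and "X \<in> measurable M (count_space (cube n))"
    and "MTP2 n (distr M (count_space (cube n)) X)"
    and "\<And>i j. i \<in> {1..n} \<Longrightarrow> j \<in> {1..n} \<Longrightarrow> w i j = w j i"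
    and "\<And>i j. (i, j) \<in> edge_pairs n \<Longrightarrow> w i j \<ge> 0"
  shows "(\<Sum>(i, j)\<in>edge_pairs n. w i j * C_mat M n X i j)
           \<le> 2 * max_cut n w - (\<Sum>(i, j)\<in>edge_pairs n. w i j)"
proof -
  interpret prob_space M by (rule assms(1))
  interpret binary_vector M n X by unfold_locales (rule assms(3))
  have edge: "i \<in> {1..n}" "j \<in> {1..n}" "i \<noteq> j" if "(i, j) \<in> edge_pairs n" for i j
    using that by (auto simp: edge_pairs_def)
  have "(\<Sum>(i, j)\<in>edge_pairs n. w i j * C_mat M n X i j)
      \<le> (\<Sum>(i, j)\<in>edge_pairs n. w i j * (- (\<Sum>x\<in>cube n. score i x * score j x) / 4))"
  proof (rule sum_mono, clarify)
    fix i j assume e: "(i, j) \<in> edge_pairs n"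
    show "w i j * C_mat M n X i j \<le> w i j * (- (\<Sum>x\<in>cube n. score i x * score j x) / 4)"
      by (rule mult_left_mono[OF C_mat_le_score_inner[OF assms(4) edge[OF e]] assms(6)[OF e]])
  qed
  also have "\<dots> \<le> 2 * max_cut n w - (\<Sum>(i, j)\<in>edge_pairs n. w i j)"
  \<comment> \<open>The points of the cube index the Gaussian coordinates, and the unit vectors are
    the \<open>score i\<close>.\<close>
  proof (rule max_cut_ge_gram[OF finite_cube assms(5,6) score_unit])
    show "(\<Sum>x\<in>cube n. score i x * score j x) \<le> 0" if e: "(i, j) \<in> edge_pairs n" for i j
      by (rule score_inner_nonpos[OF assms(4) edge[OF e]])
  qed
  finally show ?thesis .
qed

end
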